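(* Let $(X,T)$ be a dynamical system and let $\mathbf{a}=(a_1,\dots,a_n)\in\mathbb{N}^n$ for some $n\in\mathbb{N}$. Then the following statements are equivalent: (1) $(X,T)$ is weakly mixing and $\mathbf{a}$-transitive; (2) $(K(X),T_K)$ is $\mathbf{a}$-transitive; (3) for every $\lambda\in(0,1]$, $(\mathbb{F}^{=\lambda}(X),T_F|_{\mathbb{F}^{=\lambda}(X)})$ is $\mathbf{a}$-transitive; (4) there exists $\lambda\in(0,1]$ such that $(\mathbb{F}^{=\lambda}(X),T_F|_{\mathbb{F}^{=\lambda}(X)})$ is $\mathbf{a}$-transitive.
   Context: A dynamical system $(X,T)$ consists of a nontrivial (more than one point) compact metric space $X$ with metric $d$ and a continuous surjection $T:X\to X$. $I=[0,1]$, $\mathbb{N}=\{1,2,\dots\}$, $\mathbb{Z}^+=\{0,1,2,\dots\}$. Hyperspace: $K(X)$ is the set of all nonempty closed subsets of $X$ with the Hausdorff metric $d_H(A,B)=\max\{\max_{x\in A}\min_{y\in B}d(x,y),\max_{y\in B}\min_{x\in A}d(x,y)\}$, and $T_K:K(X)\to K(X)$ is $T_K(A)=T(A)$. Extend $d_H$ to the empty set by $d_H(\emptyset,\emptyset)=0$ and $d_H(\emptyset,A)=d_H(A,\emptyset)=\mathrm{diam}(X)$ for $A\in K(X)$. Fuzzy sets: $\mathbb{F}(X)$ is the set of all upper semicontinuous functions $A:X\to I$. For $\alpha\in I$, $[A]_\alpha=\{x\in X:A(x)\ge\alpha\}$. The levelwise metric on $\mathbb{F}(X)$ is $d_\infty(A,B)=\sup\{d_H([A]_\alpha,[B]_\alpha):\alpha\in(0,1]\}$.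 For $\lambda\in(0,1]$, $\mathbb{F}^{=\lambda}(X)=\{A\in\mathbb{F}(X):\max_{x\in X}A(x)=\lambda\}$, with the metric $d_\infty$. Zadeh's extension $T_F:\mathbb{F}(X)\to\mathbb{F}(X)$ is $T_F(A)(x)=\sup\{A(y):y\in T^{-1}(x)\}$. For a continuous self-map $S$ of a metric space $Y$: $(Y,S)$ is transitive if for all nonempty open $U,V\subset Y$ there is $m\in\mathbb{Z}^+$ with $S^m(U)\cap V\ne\emptyset$; it is weakly mixing if $(Y\times Y,S\times S)$ is transitive; it is $\mathbf{a}$-transitive, for $\mathbf{a}=(a_1,\dots,a_n)\in\mathbb{N}^n$, if the product system $(Y^n,S^{a_1}\times S^{a_2}\times\cdots\times S^{a_n})$ is transitive. *)

theory Defs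
  imports "HOL-Analysis.Analysis"
begin

definition dynamical_system :: "('a::metric_space \<Rightarrow> 'a) \<Rightarrow> bool" where
  "dynamical_system T \<longleftrightarrow>
     compact (UNIV :: 'a set) \<and> (\<exists>x y :: 'a. x \<noteq> y) \<and> continuous_on UNIV T \<and> surj T"

text \<open>The underlying space of a system is given as a topology \<open>Y\<close>, whose points are
  \<open>topspace Y\<close>; open sets of \<open>Y\<close> are subsets of \<open>topspace Y\<close>, so only the values of \<open>S\<close> on
  \<open>topspace Y\<close> matter.\<close>

definition transitive_system :: "'b topology \<Rightarrow> ('b \<Rightarrow> 'b) \<Rightarrow> bool" where
  "transitive_system Y S \<longleftrightarrow>
     (\<forall>U V. openin Y U \<and> U \<noteq> {} \<and> openin Y V \<and> V \<noteq> {} \<longrightarrow>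
        (\<exists>m::nat. (S ^^ m) ` U \<inter> V \<noteq> {}))"

definition weakly_mixing :: "'b topology \<Rightarrow> ('b \<Rightarrow> 'b) \<Rightarrow> bool" where
  "weakly_mixing Y S \<longleftrightarrow> transitive_system (prod_topology Y Y) (map_prod S S)"

text \<open>The vector \<open>(a\<^sub>1, \<dots>, a\<^sub>n)\<close> is the restriction of \<open>a\<close> to \<open>{1..n}\<close>; points of \<open>Y\<^sup>n\<close> are the
  functions in \<open>{1..n} \<rightarrow>\<^sub>E topspace Y\<close>.\<close>

definition vec_transitive :: "nat \<Rightarrow> (nat \<Rightarrow> nat) \<Rightarrow> 'b topology \<Rightarrow> ('b \<Rightarrow> 'b) \<Rightarrow> bool" where
  "vec_transitive n a Y S \<longleftrightarrow>
     transitive_system (product_topology (\<lambda>_. Y) {1..n}) (\<lambda>x. \<lambda>i\<in>{1..n}. (S ^^ a i) (x i))"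

definition hyperspace :: "'a::metric_space set set" where
  "hyperspace = {A. closed A \<and> A \<noteq> {}}"

text \<open>On nonempty closed subsets of a compact space the suprema and infima below
  are attained, so they are the maxima and minima of the Hausdorff metric.\<close>

definition hausdorff_dist :: "'a::metric_space set \<Rightarrow> 'a set \<Rightarrow> real" where
  "hausdorff_dist A B =
     (if A = {} \<and> B = {} then 0
      else if A = {} \<or> B = {} then diameter (UNIV :: 'a set)
      else max (SUP x\<in>A. INF y\<in>B. dist x y) (SUP y\<in>B. INF x\<in>A. dist x y))"

definition hyperspace_topology :: "'a::metric_space set topology" where
  "hyperspace_topology = Metric_space.mtopology hyperspace hausdorff_dist"

definition hyperspace_map :: "('a \<Rightarrow> 'a) \<Rightarrow> 'a set \<Rightarrow> 'a set" where
  "hyperspace_map T A = T ` A"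

definition upper_semicontinuous :: "('a::topological_space \<Rightarrow> real) \<Rightarrow> bool" where
  "upper_semicontinuous f \<longleftrightarrow> (\<forall>x c. f x < c \<longrightarrow> (\<forall>\<^sub>F y in nhds x. f y < c))"

definition fuzzy_sets :: "('a::topological_space \<Rightarrow> real) set" where
  "fuzzy_sets = {A. upper_semicontinuous A \<and> range A \<subseteq> {0..1}}"

definition level_set :: "('a \<Rightarrow> real) \<Rightarrow> real \<Rightarrow> 'a set" where
  "level_set A \<alpha> = {x. A x \<ge> \<alpha>}"

definition levelwise_dist :: "('a::metric_space \<Rightarrow> real) \<Rightarrow> ('a \<Rightarrow> real) \<Rightarrow> real" where
  "levelwise_dist A B = (SUP \<alpha>\<in>{0<..1}. hausdorff_dist (level_set A \<alpha>) (level_set B \<alpha>))"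

definition fuzzy_sets_height :: "real \<Rightarrow> ('a::topological_space \<Rightarrow> real) set" where
  "fuzzy_sets_height l = {A \<in> fuzzy_sets. (\<exists>x. A x = l) \<and> (\<forall>x. A x \<le> l)}"

definition fuzzy_topology :: "real \<Rightarrow> ('a::metric_space \<Rightarrow> real) topology" where
  "fuzzy_topology l = Metric_space.mtopology (fuzzy_sets_height l) levelwise_dist"

definition zadeh_extension :: "('a \<Rightarrow> 'a) \<Rightarrow> ('a \<Rightarrow> real) \<Rightarrow> 'a \<Rightarrow> real" where
  "zadeh_extension T A x = (SUP y\<in>T -` {x}. A y)"

text \<open>\<open>Metric_space.mtopology M d\<close> is meaningful only if \<open>d\<close> is a metric on
  \<open>M\<close>; this holds for both distances used above.\<close>

lemma hausdorff_dist_nonempty: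
  fixes A B :: "'a::metric_space set"
  assumes "A \<noteq> {}" "B \<noteq> {}"
  shows "hausdorff_dist A B = max (SUP x\<in>A. infdist x B) (SUP y\<in>B. infdist y A)"
  using assms by (simp add: hausdorff_dist_def infdist_def dist_commute)

lemma infdist_le_diameter:
  fixes B :: "'a::metric_space set"
  assumes "compact (UNIV :: 'a set)" "B \<noteq> {}"
  shows "infdist x B \<le> diameter (UNIV :: 'a set)"
proof -
  obtain b where "b \<in> B" using assms by auto
  then have "infdist x B \<le> dist x b" by (rule infdist_le)
  also have "\<dots> \<le> diameter (UNIV :: 'a set)"
    using assms by (intro diameter_bounded_bound compact_imp_bounded) auto
  finally show ?thesis .
qed

lemma hausdorff_dist_le_iff:
  fixes A B :: "'a::metric_space set"
  assumes "compact (UNIV :: 'a set)" "A \<noteq> {}" "B \<noteq> {}"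
  shows "hausdorff_dist A B \<le> r \<longleftrightarrow> (\<forall>x\<in>A. infdist x B \<le> r) \<and> (\<forall>y\<in>B. infdist y A \<le> r)"
proof -
  have "bdd_above ((\<lambda>x. infdist x B) ` A)" "bdd_above ((\<lambda>x. infdist x A) ` B)"
    using infdist_le_diameter assms by (auto intro!: bdd_aboveI2)
  then show ?thesis
    using assms by (simp add: hausdorff_dist_nonempty cSUP_le_iff)
qed

lemma hausdorff_dist_commute: "hausdorff_dist A B = hausdorff_dist B A"
  unfolding hausdorff_dist_def by (simp add: max.commute dist_commute)

lemma hausdorff_dist_le_diameter:
  fixes A B :: "'a::metric_space set"
  assumes "compact (UNIV :: 'a set)"
  shows "hausdorff_dist A B \<le> diameter (UNIV :: 'a set)"
proof (cases "A = {} \<or> B = {}")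
  case True
  then show ?thesis
    using diameter_ge_0[OF compact_imp_bounded[OF assms]] by (auto simp: hausdorff_dist_def)
next
  case False
  then show ?thesis
    using assms by (simp add: hausdorff_dist_le_iff infdist_le_diameter)
qed

lemma hausdorff_dist_nonneg:
  fixes A B :: "'a::metric_space set"
  assumes "compact (UNIV :: 'a set)"
  shows "0 \<le> hausdorff_dist A B"
proof (cases "A = {} \<or> B = {}")
  case True
  then show ?thesis
    using diameter_ge_0[OF compact_imp_bounded[OF assms]] by (auto simp: hausdorff_dist_def)
next
  case False
  then obtain x where "x \<in> A" by auto
  then have "infdist x B \<le> hausdorff_dist A B"
    using False hausdorff_dist_le_iff[OF assms, of A B "hausdorff_dist A B"] by auto
  then show ?thesis using infdist_nonneg[of x B] by linarith
qed

lemma diameter_UNIV_pos: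
  assumes "compact (UNIV :: 'a::metric_space set)" "x \<noteq> (y :: 'a)"
  shows "0 < diameter (UNIV :: 'a set)"
proof -
  have "dist x y \<le> diameter (UNIV :: 'a set)"
    using assms by (intro diameter_bounded_bound compact_imp_bounded) auto
  with assms show ?thesis by (meson less_le_trans zero_less_dist_iff)
qed

lemma hausdorff_dist_eq_0_iff:
  fixes A B :: "'a::metric_space set"
  assumes "compact (UNIV :: 'a set)" "\<exists>x y :: 'a. x \<noteq> y" "closed A" "closed B"
  shows "hausdorff_dist A B = 0 \<longleftrightarrow> A = B"
proof (cases "A = {} \<or> B = {}")
  case True
  then show ?thesis
    using assms diameter_UNIV_pos[OF assms(1)] by (force simp: hausdorff_dist_def)
next
  case False
  have "hausdorff_dist A B = 0 \<longleftrightarrow> hausdorff_dist A B \<le> 0"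
    using hausdorff_dist_nonneg[OF assms(1), of A B] by linarith
  also have "\<dots> \<longleftrightarrow> (\<forall>x\<in>A. infdist x B = 0) \<and> (\<forall>y\<in>B. infdist y A = 0)"
    using False assms by (simp add: hausdorff_dist_le_iff order_antisym_conv infdist_nonneg)
  also have "\<dots> \<longleftrightarrow> A = B"
    using False assms in_closed_iff_infdist_zero[of A] in_closed_iff_infdist_zero[of B] by blast
  finally show ?thesis .
qed

lemma hausdorff_dist_triangle_aux:
  fixes A B C :: "'a::metric_space set"
  assumes c: "compact (UNIV :: 'a set)" and B: "closed B"
    and ne: "A \<noteq> {}" "B \<noteq> {}" "C \<noteq> {}" and x: "x \<in> A"
  shows "infdist x C \<le> hausdorff_dist A B + hausdorff_dist B C"
proof -
  have AB: "infdist x B \<le> hausdorff_dist A B"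
    using hausdorff_dist_le_iff[OF c ne(1,2), of "hausdorff_dist A B"] x by auto
  have "compact B" using compact_Int_closed[OF c B] by simp
  then obtain b where b: "b \<in> B" "\<And>y. y \<in> B \<Longrightarrow> dist x b \<le> dist x y"
    using continuous_attains_inf[OF _ ne(2), of "dist x"] continuous_on_dist[OF continuous_on_const[of B x] continuous_on_id]
    by blast
  have "dist x b \<le> infdist x B"
    unfolding infdist_notempty[OF ne(2)] using b ne(2) by (intro cINF_greatest) auto
  moreover have "infdist b C \<le> hausdorff_dist B C"
    using hausdorff_dist_le_iff[OF c ne(2,3), of "hausdorff_dist B C"] b by auto
  moreover have "infdist x C \<le> infdist b C + dist x b" by (rule infdist_triangle)
  ultimately show ?thesis using AB by linarith
qed

lemma hausdorff_dist_triangle: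
  fixes A B C :: "'a::metric_space set"
  assumes c: "compact (UNIV :: 'a set)" and B: "closed B"
  shows "hausdorff_dist A C \<le> hausdorff_dist A B + hausdorff_dist B C"
proof (cases "A = {} \<or> B = {} \<or> C = {}")
  case True
  have "hausdorff_dist A C \<le> diameter (UNIV :: 'a set)"
    "0 \<le> hausdorff_dist A B" "0 \<le> hausdorff_dist B C"
    using hausdorff_dist_le_diameter hausdorff_dist_nonneg c by blast+
  with True show ?thesis by (auto simp: hausdorff_dist_def split: if_splits)
next
  case False
  then show ?thesis
    using hausdorff_dist_triangle_aux[OF c B, of A C] hausdorff_dist_triangle_aux[OF c B, of C A]
    by (simp add: hausdorff_dist_le_iff c hausdorff_dist_commute add.commute)
qed

lemma Metric_space_hyperspace:
  assumes "compact (UNIV :: 'a::metric_space set)" "\<exists>x y :: 'a. x \<noteq> y"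
  shows "Metric_space (hyperspace :: 'a set set) hausdorff_dist"
proof
  fix A B C :: "'a set"
  show "0 \<le> hausdorff_dist A B" by (rule hausdorff_dist_nonneg[OF assms(1)])
  show "hausdorff_dist A B = hausdorff_dist B A" by (rule hausdorff_dist_commute)
  assume AB: "A \<in> hyperspace" "B \<in> hyperspace"
  then show "hausdorff_dist A B = 0 \<longleftrightarrow> A = B"
    using hausdorff_dist_eq_0_iff[OF assms] by (simp add: hyperspace_def)
  show "hausdorff_dist A C \<le> hausdorff_dist A B + hausdorff_dist B C"
    using hausdorff_dist_triangle[OF assms(1)] AB by (simp add: hyperspace_def)
qed

lemma closed_level_set:
  assumes "A \<in> fuzzy_sets"
  shows "closed (level_set A \<alpha>)"
proof -
  have "open {x. A x < \<alpha>}"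
    using assms unfolding fuzzy_sets_def upper_semicontinuous_def
    by (subst open_subopen) (simp add: eventually_nhds subset_eq)
  moreover have "- level_set A \<alpha> = {x. A x < \<alpha>}" by (auto simp: level_set_def)
  ultimately show ?thesis by (simp add: closed_def)
qed

lemma level_set_inject:
  assumes A: "A \<in> fuzzy_sets" and B: "B \<in> fuzzy_sets"
    and eq: "\<And>\<alpha>. \<alpha> \<in> {0<..1} \<Longrightarrow> level_set A \<alpha> = level_set B \<alpha>"
  shows "A = B"
proof -
  have "P x \<le> Q x" if "P \<in> fuzzy_sets" "Q \<in> fuzzy_sets"
    "\<And>\<alpha>. \<alpha> \<in> {0<..1} \<Longrightarrow> level_set P \<alpha> = level_set Q \<alpha>" for P Q :: "'a \<Rightarrow> real" and x
  proof (cases "P x = 0")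
    case True
    then show ?thesis using that(2) by (simp add: fuzzy_sets_def image_subset_iff)
  next
    case False
    then have "P x \<in> {0<..1}"
      using that(1) by (auto simp: fuzzy_sets_def image_subset_iff order_less_le)
    from that(3)[OF this] show ?thesis by (auto simp: level_set_def)
  qed
  from this[OF A B eq] this[OF B A eq[symmetric]] show ?thesis
    by (intro ext antisym) auto
qed

lemma levelwise_dist_upper:
  fixes A B :: "'a::metric_space \<Rightarrow> real"
  assumes "compact (UNIV :: 'a set)" "\<alpha> \<in> {0<..1}"
  shows "hausdorff_dist (level_set A \<alpha>) (level_set B \<alpha>) \<le> levelwise_dist A B"
  unfolding levelwise_dist_def using assms hausdorff_dist_le_diameter
  by (intro cSUP_upper bdd_aboveI2) blast+

lemma Metric_space_fuzzy_sets:
  assumes c: "compact (UNIV :: 'a::metric_space set)" and ne: "\<exists>x y :: 'a. x \<noteq> y"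
  shows "Metric_space (fuzzy_sets :: ('a \<Rightarrow> real) set) levelwise_dist"
proof
  fix A B :: "'a \<Rightarrow> real"
  have "0 \<le> hausdorff_dist (level_set A 1) (level_set B 1)"
    by (rule hausdorff_dist_nonneg[OF c])
  also have "\<dots> \<le> levelwise_dist A B" by (rule levelwise_dist_upper[OF c]) simp
  finally show nonneg: "0 \<le> levelwise_dist A B" .
  show "levelwise_dist A B = levelwise_dist B A"
    by (simp add: levelwise_dist_def hausdorff_dist_commute)
  assume AB: "A \<in> fuzzy_sets" "B \<in> fuzzy_sets"
  show "levelwise_dist A B = 0 \<longleftrightarrow> A = B"
  proof
    assume "A = B"
    have "hausdorff_dist (level_set B \<alpha>) (level_set B \<alpha>) = 0" for \<alpha>
      using hausdorff_dist_eq_0_iff c ne closed_level_set AB by blast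
    with \<open>A = B\<close> show "levelwise_dist A B = 0" by (simp add: levelwise_dist_def)
  next
    assume 0: "levelwise_dist A B = 0"
    have "level_set A \<alpha> = level_set B \<alpha>" if "\<alpha> \<in> {0<..1}" for \<alpha>
    proof -
      have "hausdorff_dist (level_set A \<alpha>) (level_set B \<alpha>) = 0"
        using levelwise_dist_upper[OF c that, of A B] 0 hausdorff_dist_nonneg[OF c]
        by (metis order_antisym)
      then show ?thesis using hausdorff_dist_eq_0_iff c ne closed_level_set AB by blast
    qed
    then show "A = B" using level_set_inject AB by blast
  qed
  fix C :: "'a \<Rightarrow> real"
  show "levelwise_dist A C \<le> levelwise_dist A B + levelwise_dist B C"
    unfolding levelwise_dist_def[of A C]
  proof (rule cSUP_least)
    fix \<alpha> :: real assume \<alpha>: "\<alpha> \<in> {0<..1}"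
    show "hausdorff_dist (level_set A \<alpha>) (level_set C \<alpha>) \<le> levelwise_dist A B + levelwise_dist B C"
      using hausdorff_dist_triangle[OF c closed_level_set[OF AB(2)], of "level_set A \<alpha>" "level_set C \<alpha>" \<alpha>]
        levelwise_dist_upper[OF c \<alpha>, of A B] levelwise_dist_upper[OF c \<alpha>, of B C]
      by linarith
  qed simp
qed

lemma Metric_space_fuzzy_sets_height:
  assumes "compact (UNIV :: 'a::metric_space set)" "\<exists>x y :: 'a. x \<noteq> y"
  shows "Metric_space (fuzzy_sets_height l :: ('a \<Rightarrow> real) set) levelwise_dist"
  by (rule Metric_space.subspace[OF Metric_space_fuzzy_sets[OF assms]])
     (auto simp: fuzzy_sets_height_def)

end

theory Submission
  imports Defs
begin

text \<open>From (1) to (3): weak mixing lets one shrink finitely many pairs of open sets to a single pair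
  whose return times serve all of them, so for every finite family of pairs in each coordinate
  there is a common time. Given fuzzy sets \<open>A\<close>, \<open>B\<close> of height \<open>\<lambda>\<close> and a finite \<open>\<epsilon>\<close>-net \<open>P\<close>, choose
  for \<open>x, y \<in> P\<close> a point near \<open>x\<close> that is sent near \<open>y\<close> and give it as weight the minimum of the
  maximum of \<open>A\<close> near \<open>x\<close> and the maximum of \<open>B\<close> near \<open>y\<close>. As \<open>A\<close> and \<open>B\<close> have the same height, the
  resulting finitely supported fuzzy set is close to \<open>A\<close> and its image is close to \<open>B\<close>, at all
  levels simultaneously.

  From (3) to (4) there is nothing to do. From (4) to (2): taking the top level set is a factor map onto the hyperspace.

  From (2) to (1): the hyperspace gives, for open \<open>U\<close>, \<open>V\<close>, \<open>W\<close>, a time at which \<open>U\<close> meets both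
  \<open>V\<close> and \<open>W\<close>; for a transitive surjection this already implies weak mixing.\<close>

section \<open>Transitivity in terms of boxes\<close>

text \<open>The hypothesis matters at \<open>m = 0\<close>, where the left side is \<open>x\<close>
  itself and the right side is its restriction to \<open>I\<close>.\<close>

lemma funpow_restrict_apply:
  fixes S :: "'b \<Rightarrow> 'b"
  assumes "x \<in> extensional I"
  shows "((\<lambda>x. \<lambda>i\<in>I. (S ^^ a i) (x i)) ^^ m) x = (\<lambda>i\<in>I. (S ^^ (a i * m)) (x i))"
proof (induction m)
  case 0
  then show ?case using assms by (simp add: extensional_restrict)
next
  case (Suc m)
  then show ?case by (auto simp: funpow_add restrict_def)
qed

text \<open>Open boxes form a base of the finite product, and a box splits into its coordinates,
  which share only the time \<open>m\<close>; in coordinate \<open>i\<close> this means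
  \<open>a i * m\<close> steps of \<open>S\<close>.\<close>

lemma vec_transitive_iff:
  "vec_transitive n a Y S \<longleftrightarrow>
     (\<forall>U V. (\<forall>i\<in>{1..n}. openin Y (U i) \<and> U i \<noteq> {} \<and> openin Y (V i) \<and> V i \<noteq> {}) \<longrightarrow>
        (\<exists>m. \<forall>i\<in>{1..n}. \<exists>x\<in>U i. (S ^^ (a i * m)) x \<in> V i))"
  (is "_ \<longleftrightarrow> ?R")
proof
  assume L: "vec_transitive n a Y S"
  show ?R
  proof (intro allI impI)
    fix U V
    assume UV: "\<forall>i\<in>{1..n}. openin Y (U i) \<and> U i \<noteq> {} \<and> openin Y (V i) \<and> V i \<noteq> {}"
    let ?P = "product_topology (\<lambda>_. Y) {1..n}"
    have "openin ?P (PiE {1..n} U)" "openin ?P (PiE {1..n} V)"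
      "PiE {1..n} U \<noteq> {}" "PiE {1..n} V \<noteq> {}"
      using UV by (auto simp: openin_PiE_gen PiE_eq_empty_iff)
    then obtain m where
      "((\<lambda>x. \<lambda>i\<in>{1..n}. (S ^^ a i) (x i)) ^^ m) ` PiE {1..n} U \<inter> PiE {1..n} V \<noteq> {}"
      using L unfolding vec_transitive_def transitive_system_def by meson
    then obtain x where x: "x \<in> PiE {1..n} U"
      and "((\<lambda>x. \<lambda>i\<in>{1..n}. (S ^^ a i) (x i)) ^^ m) x \<in> PiE {1..n} V"
      by auto
    then have "(\<lambda>i\<in>{1..n}. (S ^^ (a i * m)) (x i)) \<in> PiE {1..n} V"
      by (simp add: funpow_restrict_apply PiE_def)
    then have "\<forall>i\<in>{1..n}. (S ^^ (a i * m)) (x i) \<in> V i" by (auto simp: PiE_iff)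
    with x show "\<exists>m. \<forall>i\<in>{1..n}. \<exists>x\<in>U i. (S ^^ (a i * m)) x \<in> V i"
      by (auto simp: PiE_iff)
  qed
next
  assume R: ?R
  show "vec_transitive n a Y S"
    unfolding vec_transitive_def transitive_system_def
  proof (intro allI impI, elim conjE)
    let ?P = "product_topology (\<lambda>_. Y) {1..n}"
    fix U V
    assume UV: "openin ?P U" "U \<noteq> {}" "openin ?P V" "V \<noteq> {}"
    have box: "\<exists>B. (\<forall>i\<in>{1..n}. openin Y (B i) \<and> B i \<noteq> {}) \<and> PiE {1..n} B \<subseteq> W"
      if W: "openin ?P W" "W \<noteq> {}" for W
    proof -
      obtain x where "x \<in> W" using W by auto
      then obtain B where B: "\<forall>i\<in>{1..n}. openin Y (B i)" "x \<in> PiE {1..n} B" "PiE {1..n} B \<subseteq> W"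
        using W(1) unfolding openin_product_topology_alt by meson
      then show ?thesis by (intro exI[of _ B]) (auto simp: PiE_iff)
    qed
    obtain B where B: "\<forall>i\<in>{1..n}. openin Y (B i) \<and> B i \<noteq> {}" "PiE {1..n} B \<subseteq> U"
      using box[OF UV(1,2)] by auto
    obtain C where C: "\<forall>i\<in>{1..n}. openin Y (C i) \<and> C i \<noteq> {}" "PiE {1..n} C \<subseteq> V"
      using box[OF UV(3,4)] by auto
    obtain m where "\<forall>i\<in>{1..n}. \<exists>x\<in>B i. (S ^^ (a i * m)) x \<in> C i"
      using R[rule_format, of B C] B(1) C(1) by auto
    then obtain x where x: "\<forall>i\<in>{1..n}. x i \<in> B i \<and> (S ^^ (a i * m)) (x i) \<in> C i"
      by metis
    \<comment> \<open>The pointwise choice is arbitrary outside \<open>{1..n}\<close>; restricting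
      it gives a genuine point of the product.\<close>
    let ?x = "restrict x {1..n}"
    have "?x \<in> U" using B(2) x by auto
    moreover have "((\<lambda>x. \<lambda>i\<in>{1..n}. (S ^^ a i) (x i)) ^^ m) ?x \<in> V"
      using C(2) x by (auto simp: funpow_restrict_apply)
    ultimately show "\<exists>m. ((\<lambda>x. \<lambda>i\<in>{1..n}. (S ^^ a i) (x i)) ^^ m) ` U \<inter> V \<noteq> {}" by blast
  qed
qed

lemma funpow_map_prod:
  fixes S :: "'a \<Rightarrow> 'a" and T :: "'b \<Rightarrow> 'b"
  shows "(map_prod S T ^^ m) (x, y) = ((S ^^ m) x, (T ^^ m) y)"
  by (induction m) auto

text \<open>Open rectangles form a base of the product of two copies of \<open>Y\<close>, so it
  suffices to test transitivity on them.\<close>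

lemma weakly_mixing_iff:
  "weakly_mixing Y S \<longleftrightarrow>
     (\<forall>U U' V V'. openin Y U \<and> U \<noteq> {} \<and> openin Y U' \<and> U' \<noteq> {} \<and>
        openin Y V \<and> V \<noteq> {} \<and> openin Y V' \<and> V' \<noteq> {} \<longrightarrow>
        (\<exists>m. (\<exists>x\<in>U. (S ^^ m) x \<in> V) \<and> (\<exists>x\<in>U'. (S ^^ m) x \<in> V')))"
  (is "_ \<longleftrightarrow> ?R")
proof
  assume L: "weakly_mixing Y S"
  show ?R
  proof (intro allI impI, elim conjE)
    fix U U' V V'
    assume "openin Y U" "U \<noteq> {}" "openin Y U'" "U' \<noteq> {}"
      "openin Y V" "V \<noteq> {}" "openin Y V'" "V' \<noteq> {}"
    then have "openin (prod_topology Y Y) (U \<times> U')" "openin (prod_topology Y Y) (V \<times> V')"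
      "U \<times> U' \<noteq> {}" "V \<times> V' \<noteq> {}"
      by (auto simp: openin_prod_Times_iff)
    then obtain m where "(map_prod S S ^^ m) ` (U \<times> U') \<inter> (V \<times> V') \<noteq> {}"
      using L unfolding weakly_mixing_def transitive_system_def by meson
    then show "\<exists>m. (\<exists>x\<in>U. (S ^^ m) x \<in> V) \<and> (\<exists>x\<in>U'. (S ^^ m) x \<in> V')"
      by (force simp: funpow_map_prod)
  qed
next
  assume R: ?R
  show "weakly_mixing Y S"
    unfolding weakly_mixing_def transitive_system_def
  proof (intro allI impI, elim conjE)
    let ?P = "prod_topology Y Y"
    fix U V
    assume UV: "openin ?P U" "U \<noteq> {}" "openin ?P V" "V \<noteq> {}"
    have box: "\<exists>B C. openin Y B \<and> openin Y C \<and> B \<noteq> {} \<and> C \<noteq> {} \<and> B \<times> C \<subseteq> W"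
      if W: "openin ?P W" "W \<noteq> {}" for W
    proof -
      obtain x y where "(x, y) \<in> W" using W by auto
      then obtain B C where "openin Y B" "openin Y C" "x \<in> B" "y \<in> C" "B \<times> C \<subseteq> W"
        using W(1) unfolding openin_prod_topology_alt by meson
      then show ?thesis by blast
    qed
    obtain B B' where B: "openin Y B" "openin Y B'" "B \<noteq> {}" "B' \<noteq> {}" "B \<times> B' \<subseteq> U"
      using box[OF UV(1,2)] by blast
    obtain C C' where C: "openin Y C" "openin Y C'" "C \<noteq> {}" "C' \<noteq> {}" "C \<times> C' \<subseteq> V"
      using box[OF UV(3,4)] by blast
    obtain m x x' where "x \<in> B" "(S ^^ m) x \<in> C" "x' \<in> B'" "(S ^^ m) x' \<in> C'"
      using R[rule_format, of B B' C C'] B C by auto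
    then have "(x, x') \<in> U" "(map_prod S S ^^ m) (x, x') \<in> V"
      using B C by (auto simp: funpow_map_prod)
    then show "\<exists>m. (map_prod S S ^^ m) ` U \<inter> V \<noteq> {}" by blast
  qed
qed

section \<open>Weak mixing\<close>

lemma continuous_on_funpow:
  assumes "continuous_on UNIV (T :: 'a::topological_space \<Rightarrow> 'a)"
  shows "continuous_on UNIV (T ^^ m)"
proof (induction m)
  case (Suc m)
  then show ?case
    using continuous_on_compose2[OF assms Suc] by (simp add: comp_def)
qed (simp add: id_def)

lemma open_vimage_funpow:
  assumes "continuous_on UNIV (T :: 'a::topological_space \<Rightarrow> 'a)" "open U"
  shows "open ((T ^^ m) -` U)"
  using open_vimage[OF assms(2) continuous_on_funpow[OF assms(1)]] .

text \<open>This is Furstenberg's intersection lemma for return times. Induct on \<open>J\<close>: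
  if some time \<open>p\<close> takes part of \<open>U'\<close> into \<open>U k\<close> and part of
  \<open>V'\<close> into \<open>V k\<close>, restrict both sets to these parts. A return
  \<open>x\<close> from the first part to the second still serves the earlier pairs, and
  \<open>(T ^^ p) x\<close> serves the pair \<open>k\<close> because powers of \<open>T\<close>
  commute.\<close>

lemma weakly_mixing_shrink:
  fixes T :: "'a::topological_space \<Rightarrow> 'a"
  assumes wm: "weakly_mixing euclidean T" and cont: "continuous_on UNIV T"
    and "finite J" and "\<forall>j\<in>J. open (U j) \<and> U j \<noteq> {} \<and> open (V j) \<and> V j \<noteq> {}"
  shows "\<exists>U' V'. open U' \<and> U' \<noteq> {} \<and> open V' \<and> V' \<noteq> {} \<and>
    (\<forall>m. (\<exists>x\<in>U'. (T ^^ m) x \<in> V') \<longrightarrow> (\<forall>j\<in>J. \<exists>x\<in>U j. (T ^^ m) x \<in> V j))"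
  using assms(3,4)
proof (induction J)
  case empty
  show ?case by (intro exI[of _ UNIV]) auto
next
  case (insert k J)
  then obtain U' V' where UV: "open U'" "U' \<noteq> {}" "open V'" "V' \<noteq> {}"
    and ret: "\<And>m. (\<exists>x\<in>U'. (T ^^ m) x \<in> V') \<Longrightarrow> \<forall>j\<in>J. \<exists>x\<in>U j. (T ^^ m) x \<in> V j"
    by auto
  have k: "open (U k)" "U k \<noteq> {}" "open (V k)" "V k \<noteq> {}" using insert by auto
  \<comment> \<open>Weak mixing is applied crosswise, from source to source and from target to
    target.\<close>
  obtain p where p: "\<exists>x\<in>U'. (T ^^ p) x \<in> U k" "\<exists>x\<in>V'. (T ^^ p) x \<in> V k"
    using wm[unfolded weakly_mixing_iff, rule_format, of U' V' "U k" "V k"] UV k by auto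
  define P where "P = U' \<inter> (T ^^ p) -` U k"
  define Q where "Q = V' \<inter> (T ^^ p) -` V k"
  have "open P" "open Q" "P \<noteq> {}" "Q \<noteq> {}"
    using UV k p open_vimage_funpow[OF cont] by (auto simp: P_def Q_def)
  moreover have "\<forall>j\<in>insert k J. \<exists>x\<in>U j. (T ^^ m) x \<in> V j"
    if hit: "\<exists>x\<in>P. (T ^^ m) x \<in> Q" for m
  proof -
    obtain x where x: "x \<in> P" "(T ^^ m) x \<in> Q" using hit by auto
    have "(T ^^ m) ((T ^^ p) x) = (T ^^ p) ((T ^^ m) x)"
      by (metis add.commute comp_apply funpow_add)
    then have "(T ^^ p) x \<in> U k" "(T ^^ m) ((T ^^ p) x) \<in> V k"
      using x by (auto simp: P_def Q_def)
    then show ?thesis using ret[of m] x by (auto simp: P_def Q_def)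
  qed
  ultimately show ?case by blast
qed

text \<open>Weak mixing collapses the family over \<open>J\<close> to one pair in each coordinate,
  and transitivity along \<open>a\<close> then finds a time for these \<open>n\<close>
  pairs.\<close>

lemma weakly_mixing_vec_transitive_family:
  fixes T :: "'a::topological_space \<Rightarrow> 'a"
  assumes wm: "weakly_mixing euclidean T" and tr: "vec_transitive n a euclidean T"
    and cont: "continuous_on UNIV T" and J: "finite J"
    and UV: "\<And>i j. i \<in> {1..n} \<Longrightarrow> j \<in> J \<Longrightarrow> open (U i j) \<and> U i j \<noteq> {} \<and> open (V i j) \<and> V i j \<noteq> {}"
  obtains m where "\<And>i j. i \<in> {1..n} \<Longrightarrow> j \<in> J \<Longrightarrow> \<exists>x\<in>U i j. (T ^^ (a i * m)) x \<in> V i j"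
proof -
  have "\<forall>i\<in>{1..n}. \<exists>U' V'. open U' \<and> U' \<noteq> {} \<and> open V' \<and> V' \<noteq> {} \<and>
    (\<forall>m. (\<exists>x\<in>U'. (T ^^ m) x \<in> V') \<longrightarrow> (\<forall>j\<in>J. \<exists>x\<in>U i j. (T ^^ m) x \<in> V i j))"
    using UV by (intro ballI weakly_mixing_shrink[OF wm cont J]) auto
  then obtain U' V' where "\<forall>i\<in>{1..n}. open (U' i) \<and> U' i \<noteq> {} \<and> open (V' i) \<and> V' i \<noteq> {}"
    and ret: "\<And>i m. i \<in> {1..n} \<Longrightarrow> \<exists>x\<in>U' i. (T ^^ m) x \<in> V' i \<Longrightarrow>
      \<forall>j\<in>J. \<exists>x\<in>U i j. (T ^^ m) x \<in> V i j"
    by metis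
  then obtain m where "\<forall>i\<in>{1..n}. \<exists>x\<in>U' i. (T ^^ (a i * m)) x \<in> V' i"
    using tr[unfolded vec_transitive_iff, rule_format, of U' V'] by auto
  then show thesis using ret by (intro that) blast
qed

text \<open>Let \<open>k\<close> be a time from \<open>U\<close> to \<open>U'\<close>, and start
  from the part \<open>W\<close> of \<open>U\<close> sent into \<open>U'\<close>. A common time from
  \<open>W\<close> to \<open>V\<close> and to the preimage of \<open>V'\<close> under
  \<open>T ^^ k\<close> works for both pairs: the second orbit, shifted by \<open>k\<close>, starts
  in \<open>U'\<close> and ends in \<open>V'\<close>. Surjectivity makes that preimage
  nonempty.\<close>

lemma weakly_mixingI_common_source:
  fixes T :: "'a::topological_space \<Rightarrow> 'a"
  assumes cont: "continuous_on UNIV T" and surj: "surj T"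
    and common: "\<And>U V W. open U \<Longrightarrow> U \<noteq> {} \<Longrightarrow> open V \<Longrightarrow> V \<noteq> {} \<Longrightarrow> open W \<Longrightarrow> W \<noteq> {} \<Longrightarrow>
      \<exists>m. (\<exists>x\<in>U. (T ^^ m) x \<in> V) \<and> (\<exists>x\<in>U. (T ^^ m) x \<in> W)"
  shows "weakly_mixing euclidean T"
  unfolding weakly_mixing_iff open_openin[symmetric]
proof (intro allI impI, elim conjE)
  fix U U' V V' :: "'a set"
  assume o: "open U" "open U'" "open V" "open V'"
    and ne: "U \<noteq> {}" "U' \<noteq> {}" "V \<noteq> {}" "V' \<noteq> {}"
  obtain k where k: "\<exists>x\<in>U. (T ^^ k) x \<in> U'"
    \<comment> \<open>With both targets equal to \<open>U'\<close>, the hypothesis reduces to plain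
      transitivity.\<close>
    using common[OF o(1) ne(1) o(2) ne(2) o(2) ne(2)] by auto
  define W where "W = U \<inter> (T ^^ k) -` U'"
  have W: "open W" "W \<noteq> {}" using k o open_vimage_funpow[OF cont] by (auto simp: W_def)
  have V: "(T ^^ k) -` V' \<noteq> {}"
    using surj_fn[OF surj, of k] ne(4) by (metis surj_vimage_empty)
  obtain m x y where xy: "x \<in> W" "(T ^^ m) x \<in> V" "y \<in> W" "(T ^^ m) y \<in> (T ^^ k) -` V'"
    using common[OF W o(3) ne(3) open_vimage_funpow[OF cont o(4)] V] by blast
  have "(T ^^ m) ((T ^^ k) y) = (T ^^ k) ((T ^^ m) y)"
    by (metis add.commute comp_apply funpow_add)
  with xy have "(T ^^ k) y \<in> U'" "(T ^^ m) ((T ^^ k) y) \<in> V'" by (auto simp: W_def)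
  with xy show "\<exists>m. (\<exists>x\<in>U. (T ^^ m) x \<in> V) \<and> (\<exists>x\<in>U'. (T ^^ m) x \<in> V')"
    by (auto simp: W_def)
qed

section \<open>The hyperspace\<close>

text \<open>The strict inequality yields a witness without the infimum being attained, so neither
  set has to be closed.\<close>

lemma hausdorff_dist_lessD:
  fixes A B :: "'a::metric_space set"
  assumes c: "compact (UNIV :: 'a set)" and ne: "B \<noteq> {}"
    and less: "hausdorff_dist A B < r" and x: "x \<in> A"
  shows "\<exists>y\<in>B. dist x y < r"
proof -
  have "infdist x B \<le> hausdorff_dist A B"
    using hausdorff_dist_le_iff[OF c _ ne, of A "hausdorff_dist A B"] x by auto
  then have "(INF y\<in>B. dist x y) < r" using less by (simp add: infdist_notempty[OF ne])
  then show ?thesis by (subst (asm) cINF_less_iff) (auto simp: ne)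
qed

text \<open>Empty sets are covered, since the two approximation hypotheses make \<open>A\<close> and
  \<open>B\<close> empty together. This handles level sets above the height of a fuzzy set.\<close>

lemma hausdorff_dist_leI:
  fixes A B :: "'a::metric_space set"
  assumes c: "compact (UNIV :: 'a set)" and r: "0 \<le> r"
    and AB: "\<And>x. x \<in> A \<Longrightarrow> \<exists>y\<in>B. dist x y \<le> r" and BA: "\<And>y. y \<in> B \<Longrightarrow> \<exists>x\<in>A. dist x y \<le> r"
  shows "hausdorff_dist A B \<le> r"
proof (cases "A = {} \<or> B = {}")
  case True
  then have "A = {}" "B = {}" using AB BA by auto
  then show ?thesis using r by (simp add: hausdorff_dist_def)
next
  case False
  then show ?thesis
    using AB BA by (auto simp: hausdorff_dist_le_iff[OF c] dist_commute intro: infdist_le2)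
qed

lemma funpow_hyperspace_map: "(hyperspace_map T ^^ m) A = (T ^^ m) ` A"
  by (induction m) (auto simp: hyperspace_map_def image_comp)

section \<open>Open sets of the hyperspace: containment in, and intersection with, an open
  set\<close>

lemma openin_hyperspace_topology:
  fixes \<U> :: "'a::metric_space set set"
  assumes "dynamical_system (T :: 'a \<Rightarrow> 'a)"
  shows "openin hyperspace_topology \<U> \<longleftrightarrow>
    \<U> \<subseteq> hyperspace \<and> (\<forall>A\<in>\<U>. \<exists>r>0. \<forall>B\<in>hyperspace. hausdorff_dist A B < r \<longrightarrow> B \<in> \<U>)"
proof -
  interpret Metric_space "hyperspace :: 'a set set" hausdorff_dist
    using assms by (intro Metric_space_hyperspace) (auto simp: dynamical_system_def)
  show ?thesis
    unfolding hyperspace_topology_def openin_mtopology subset_iff in_mball by blast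
qed

text \<open>A compact subset of an open set has a uniform neighbourhood inside it. These sets and
  the ones in the next lemma are the subbasic sets of the Vietoris topology.\<close>

lemma openin_hyperspace_contained:
  fixes U :: "'a::metric_space set"
  assumes ds: "dynamical_system (T :: 'a \<Rightarrow> 'a)" and U: "open U"
  shows "openin hyperspace_topology {A \<in> hyperspace. A \<subseteq> U}"
  unfolding openin_hyperspace_topology[OF ds]
proof (intro conjI ballI)
  have c: "compact (UNIV :: 'a set)" using ds by (simp add: dynamical_system_def)
  fix A assume "A \<in> {A \<in> hyperspace. A \<subseteq> U}"
  then have A: "closed A" "A \<noteq> {}" "A \<subseteq> U" by (auto simp: hyperspace_def)
  have "compact A" using compact_Int_closed[OF c A(1)] by simp
  then obtain r where r: "r > 0" "(\<Union>x\<in>A. ball x r) \<subseteq> U"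
    using compact_subset_open_imp_ball_epsilon_subset[OF _ U A(3)] by blast
  have "B \<subseteq> U" if less: "hausdorff_dist A B < r" for B
  proof
    fix b assume "b \<in> B"
    then obtain x where "x \<in> A" "dist b x < r"
      using hausdorff_dist_lessD[OF c A(2), of B r b] less
      by (auto simp: hausdorff_dist_commute[of B A])
    then show "b \<in> U" using r(2) by (force simp: dist_commute)
  qed
  then show "\<exists>r>0. \<forall>B\<in>hyperspace. hausdorff_dist A B < r \<longrightarrow> B \<in> {A \<in> hyperspace. A \<subseteq> U}"
    using r(1) by auto
qed auto

text \<open>One point of \<open>A\<close> in \<open>U\<close> with a ball around it inside
  \<open>U\<close> suffices: every \<open>B\<close> close to \<open>A\<close> has a point in that
  ball.\<close>

lemma openin_hyperspace_meets:
  fixes U :: "'a::metric_space set"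
  assumes ds: "dynamical_system (T :: 'a \<Rightarrow> 'a)" and U: "open U"
  shows "openin hyperspace_topology {A \<in> hyperspace. A \<inter> U \<noteq> {}}"
  unfolding openin_hyperspace_topology[OF ds]
proof (intro conjI ballI)
  have c: "compact (UNIV :: 'a set)" using ds by (simp add: dynamical_system_def)
  fix A assume "A \<in> {A \<in> hyperspace. A \<inter> U \<noteq> {}}"
  then obtain x where x: "x \<in> A" "x \<in> U" by auto
  then obtain r where r: "r > 0" "ball x r \<subseteq> U" using U by (meson open_contains_ball)
  have "B \<inter> U \<noteq> {}" if "B \<in> hyperspace" "hausdorff_dist A B < r" for B
    using hausdorff_dist_lessD[OF c _ that(2) x(1)] that(1) r(2) by (auto simp: hyperspace_def)
  then show "\<exists>r>0. \<forall>B\<in>hyperspace. hausdorff_dist A B < r \<longrightarrow> B \<in> {A \<in> hyperspace. A \<inter> U \<noteq> {}}"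
    using r(1) by auto
qed auto

lemma singleton_in_hyperspace: "{x} \<in> hyperspace"
  by (simp add: hyperspace_def)

lemma doubleton_in_hyperspace: "{x, y} \<in> hyperspace"
  by (simp add: hyperspace_def)

section \<open>From the hyperspace back to the base system\<close>

text \<open>Apply the hypothesis to the closed sets contained in \<open>U i\<close> and in
  \<open>V i\<close>; any point of the nonempty set obtained is a witness.\<close>

lemma vec_transitive_base_of_hyperspace:
  fixes T :: "'a::metric_space \<Rightarrow> 'a"
  assumes ds: "dynamical_system T"
    and tr: "vec_transitive n a hyperspace_topology (hyperspace_map T)"
  shows "vec_transitive n a euclidean T"
  unfolding vec_transitive_iff open_openin[symmetric]
proof (intro allI impI)
  fix U V :: "nat \<Rightarrow> 'a set"
  assume UV: "\<forall>i\<in>{1..n}. open (U i) \<and> U i \<noteq> {} \<and> open (V i) \<and> V i \<noteq> {}"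
  let ?in = "\<lambda>W i. {A \<in> hyperspace. A \<subseteq> W i}"
  have "openin hyperspace_topology (?in W i) \<and> ?in W i \<noteq> {}"
    if W: "open (W i)" "W i \<noteq> {}" for W :: "nat \<Rightarrow> 'a set" and i
  proof
    show "openin hyperspace_topology (?in W i)" by (rule openin_hyperspace_contained[OF ds W(1)])
    obtain x where "x \<in> W i" using W(2) by auto
    then have "{x} \<in> ?in W i" by (simp add: singleton_in_hyperspace)
    then show "?in W i \<noteq> {}" by blast
  qed
  then have "\<forall>i\<in>{1..n}. openin hyperspace_topology (?in U i) \<and> ?in U i \<noteq> {} \<and>
    openin hyperspace_topology (?in V i) \<and> ?in V i \<noteq> {}"
    using UV by meson
  then obtain m where m: "\<forall>i\<in>{1..n}. \<exists>A\<in>?in U i. (hyperspace_map T ^^ (a i * m)) A \<in> ?in V i"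
    using tr[unfolded vec_transitive_iff, rule_format, of "?in U" "?in V"] by auto
  have "\<forall>i\<in>{1..n}. \<exists>x\<in>U i. (T ^^ (a i * m)) x \<in> V i"
  proof (intro ballI)
    fix i assume "i \<in> {1..n}"
    with m obtain A where "A \<in> hyperspace" "A \<subseteq> U i" "(T ^^ (a i * m)) ` A \<subseteq> V i"
      unfolding funpow_hyperspace_map by blast
    then show "\<exists>x\<in>U i. (T ^^ (a i * m)) x \<in> V i" by (auto simp: hyperspace_def)
  qed
  then show "\<exists>m. \<forall>i\<in>{1..n}. \<exists>x\<in>U i. (T ^^ (a i * m)) x \<in> V i" by blast
qed

lemma weakly_mixing_of_hyperspace:
  fixes T :: "'a::metric_space \<Rightarrow> 'a"
  assumes ds: "dynamical_system T" and n: "n \<ge> 1"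
    and tr: "vec_transitive n a hyperspace_topology (hyperspace_map T)"
  shows "weakly_mixing euclidean T"
proof (rule weakly_mixingI_common_source)
  show "continuous_on UNIV T" "surj T" using ds by (auto simp: dynamical_system_def)
  fix U V W :: "'a set"
  assume o: "open U" "U \<noteq> {}" "open V" "V \<noteq> {}" "open W" "W \<noteq> {}"
  define \<U> where "\<U> = {A \<in> hyperspace. A \<subseteq> U}"
  \<comment> \<open>A closed subset of \<open>U\<close> whose image lies in this set has points sent
    to \<open>V\<close> and to \<open>W\<close> at the same time.\<close>
  define \<V> where "\<V> = {A \<in> hyperspace. A \<inter> V \<noteq> {}} \<inter> {A \<in> hyperspace. A \<inter> W \<noteq> {}}"
  obtain x y z where "x \<in> U" "y \<in> V" "z \<in> W" using o by auto
  then have "{x} \<in> \<U>" "{y, z} \<in> \<V>"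
    using singleton_in_hyperspace doubleton_in_hyperspace by (auto simp: \<U>_def \<V>_def)
  then have ne: "\<U> \<noteq> {}" "\<V> \<noteq> {}" by auto
  have op: "openin hyperspace_topology \<U>" "openin hyperspace_topology \<V>"
    using o openin_hyperspace_contained[OF ds] openin_hyperspace_meets[OF ds]
    by (auto simp: \<U>_def \<V>_def intro: openin_Int)
  obtain m where "\<forall>i\<in>{1..n}. \<exists>A\<in>\<U>. (hyperspace_map T ^^ (a i * m)) A \<in> \<V>"
    using tr[unfolded vec_transitive_iff, rule_format, of "\<lambda>_. \<U>" "\<lambda>_. \<V>"] ne op by auto
  \<comment> \<open>All coordinates use the same pair of open sets, so the first one, which exists
    as \<open>n \<ge> 1\<close>, is enough.\<close>
  then obtain A where "A \<in> \<U>" "(hyperspace_map T ^^ (a 1 * m)) A \<in> \<V>"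
    using n by (meson atLeastAtMost_iff order_refl)
  then show "\<exists>m. (\<exists>x\<in>U. (T ^^ m) x \<in> V) \<and> (\<exists>x\<in>U. (T ^^ m) x \<in> W)"
    by (intro exI[of _ "a 1 * m"]) (auto simp: \<U>_def \<V>_def funpow_hyperspace_map)
qed

section \<open>Fuzzy sets\<close>

text \<open>The fuzzy sets constructed below have explicit level sets, so this is the form in which
  their semicontinuity is checked.\<close>

lemma upper_semicontinuous_iff_closed_level_set:
  "upper_semicontinuous f \<longleftrightarrow> (\<forall>\<alpha>. closed (level_set f \<alpha>))"
proof -
  have "- level_set f \<alpha> = {x. f x < \<alpha>}" for \<alpha> by (auto simp: level_set_def)
  then have "(\<forall>\<alpha>. closed (level_set f \<alpha>)) \<longleftrightarrow> (\<forall>\<alpha>. open {x. f x < \<alpha>})" by (simp add: closed_def)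
  also have "\<dots> \<longleftrightarrow> upper_semicontinuous f"
    unfolding upper_semicontinuous_def
    by (subst open_subopen) (auto simp: eventually_nhds subset_eq)
  finally show ?thesis by simp
qed

text \<open>Without a maximum, the open sets where \<open>f\<close> is below \<open>f y\<close>, for
  \<open>y\<close> in \<open>K\<close>, would cover \<open>K\<close>. A finite subcover misses a
  point at which \<open>f\<close> is largest among the finitely many chosen ones.\<close>

lemma upper_semicontinuous_attains_max:
  assumes f: "upper_semicontinuous f" and K: "compact K" "K \<noteq> {}"
  shows "\<exists>x\<in>K. \<forall>y\<in>K. f y \<le> f x"
proof (rule ccontr)
  assume no_max: "\<not> ?thesis"
  have "open (- level_set f (f y))" for y
    using f by (simp add: upper_semicontinuous_iff_closed_level_set open_Compl)
  moreover have "K \<subseteq> (\<Union>y\<in>K. - level_set f (f y))"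
    using no_max by (force simp: level_set_def not_le)
  ultimately obtain F where F: "F \<subseteq> K" "finite F" "K \<subseteq> (\<Union>y\<in>F. - level_set f (f y))"
    using compactE_image[OF K(1), of K "\<lambda>y. - level_set f (f y)"] by blast
  with K have "F \<noteq> {}" by auto
  then have "Max (f ` F) \<in> f ` F" using F(2) by simp
  then obtain x where x: "x \<in> F" "f x = Max (f ` F)" by auto
  then obtain y where "y \<in> F" "f x < f y" using F by (force simp: level_set_def not_le)
  then show False using F(2) x by (metis Max_ge finite_imageI imageI not_le)
qed

section \<open>Zadeh's extension and its action on level sets\<close>

text \<open>Fibres of \<open>T\<close> are compact by continuity and nonempty by surjectivity, so
  the supremum is a maximum.\<close>

lemma zadeh_extension_attained:
  fixes T :: "'a::metric_space \<Rightarrow> 'a"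
  assumes ds: "dynamical_system T" and A: "A \<in> fuzzy_sets"
  shows "\<exists>y. T y = x \<and> zadeh_extension T A x = A y \<and> (\<forall>z. T z = x \<longrightarrow> A z \<le> A y)"
proof -
  have "closed (T -` {x})"
    using ds closed_vimage[of "{x}" T] by (simp add: dynamical_system_def)
  then have "compact (T -` {x})"
    using ds compact_Int_closed[of UNIV "T -` {x}"] by (simp add: dynamical_system_def)
  moreover have "T -` {x} \<noteq> {}" using ds unfolding dynamical_system_def by (metis empty_not_insert surj_vimage_empty)
  ultimately obtain y where y: "y \<in> T -` {x}" "\<forall>z\<in>T -` {x}. A z \<le> A y"
    using upper_semicontinuous_attains_max A unfolding fuzzy_sets_def by blast
  moreover from this have "zadeh_extension T A x = A y"
    unfolding zadeh_extension_def by (intro cSup_eq_maximum) auto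
  ultimately show ?thesis by auto
qed

text \<open>Attainment is what makes this exact at every level: a supremum of at least \<alpha>
  comes from a point of the fibre with value at least \<alpha>.\<close>

lemma level_set_zadeh_extension:
  assumes "dynamical_system T" "A \<in> fuzzy_sets"
  shows "level_set (zadeh_extension T A) \<alpha> = T ` level_set A \<alpha>"
proof (intro set_eqI)
  fix x
  obtain y where "T y = x" "zadeh_extension T A x = A y" "\<And>z. T z = x \<Longrightarrow> A z \<le> A y"
    using zadeh_extension_attained[OF assms] by blast
  then show "x \<in> level_set (zadeh_extension T A) \<alpha> \<longleftrightarrow> x \<in> T ` level_set A \<alpha>"
    by (force simp: level_set_def)
qed

lemma zadeh_extension_in_fuzzy_sets:
  fixes T :: "'a::metric_space \<Rightarrow> 'a"
  assumes ds: "dynamical_system T" and A: "A \<in> fuzzy_sets"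
  shows "zadeh_extension T A \<in> fuzzy_sets"
proof -
  have "closed (T ` level_set A \<alpha>)" for \<alpha>
  proof -
    have "compact (level_set A \<alpha>)"
      using ds compact_Int_closed[OF _ closed_level_set[OF A], of UNIV]
      by (simp add: dynamical_system_def)
    then show ?thesis
      using ds by (meson compact_continuous_image compact_imp_closed continuous_on_subset
          dynamical_system_def subset_UNIV)
  qed
  moreover have "zadeh_extension T A x \<in> {0..1}" for x
    using zadeh_extension_attained[OF ds A, of x] A by (auto simp: fuzzy_sets_def image_subset_iff)
  ultimately show ?thesis
    using level_set_zadeh_extension[OF ds A]
    by (auto simp: fuzzy_sets_def upper_semicontinuous_iff_closed_level_set)
qed

lemma zadeh_extension_in_fuzzy_sets_height:
  assumes ds: "dynamical_system T" and A: "A \<in> fuzzy_sets_height l"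
  shows "zadeh_extension T A \<in> fuzzy_sets_height l"
proof -
  have F: "A \<in> fuzzy_sets" using A by (simp add: fuzzy_sets_height_def)
  obtain x where x: "A x = l" using A by (auto simp: fuzzy_sets_height_def)
  have le: "zadeh_extension T A z \<le> l" for z
    using zadeh_extension_attained[OF ds F, of z] A by (auto simp: fuzzy_sets_height_def)
  moreover have "l \<le> zadeh_extension T A (T x)"
    using zadeh_extension_attained[OF ds F, of "T x"] x by auto
  ultimately have "zadeh_extension T A (T x) = l" by (simp add: order_antisym)
  with le show ?thesis
    using zadeh_extension_in_fuzzy_sets[OF ds F] by (auto simp: fuzzy_sets_height_def)
qed

text \<open>The two claims are proved together because the induction step for level sets needs the
  previous iterate to be a fuzzy set.\<close>

lemma funpow_zadeh_extension:
  assumes ds: "dynamical_system T" and A: "A \<in> fuzzy_sets_height l"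
  shows "(zadeh_extension T ^^ m) A \<in> fuzzy_sets_height l \<and>
    level_set ((zadeh_extension T ^^ m) A) \<alpha> = (T ^^ m) ` level_set A \<alpha>"
proof (induction m)
  case (Suc m)
  then have "(zadeh_extension T ^^ m) A \<in> fuzzy_sets" by (simp add: fuzzy_sets_height_def)
  with Suc show ?case
    using zadeh_extension_in_fuzzy_sets_height[OF ds] level_set_zadeh_extension[OF ds]
    by (simp add: image_comp)
qed (use A in simp)

section \<open>The levelwise topology and approximation by finitely supported fuzzy sets\<close>

lemma openin_fuzzy_topology:
  fixes \<U> :: "('a::metric_space \<Rightarrow> real) set"
  assumes "dynamical_system (T :: 'a \<Rightarrow> 'a)"
  shows "openin (fuzzy_topology l) \<U> \<longleftrightarrow> \<U> \<subseteq> fuzzy_sets_height l \<and>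
    (\<forall>A\<in>\<U>. \<exists>r>0. \<forall>B\<in>fuzzy_sets_height l. levelwise_dist A B < r \<longrightarrow> B \<in> \<U>)"
proof -
  interpret Metric_space "fuzzy_sets_height l :: ('a \<Rightarrow> real) set" levelwise_dist
    using assms by (intro Metric_space_fuzzy_sets_height) (auto simp: dynamical_system_def)
  show ?thesis
    unfolding fuzzy_topology_def openin_mtopology subset_iff in_mball by blast
qed

text \<open>Place weight \<open>w j\<close> at the point \<open>z j\<close>, keeping the largest
  weight where points coincide. Positive levels are then finite, hence closed, and all other levels
  are the whole space.\<close>

lemma finitely_supported_fuzzy_set:
  fixes z :: "'b \<Rightarrow> 'a::metric_space" and w :: "'b \<Rightarrow> real"
  assumes J: "finite J" and l: "0 < l" "l \<le> 1"
    and le: "\<And>j. j \<in> J \<Longrightarrow> w j \<le> l" and att: "\<exists>j\<in>J. w j = l"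
  shows "\<exists>C\<in>fuzzy_sets_height l. \<forall>\<alpha>>0. level_set C \<alpha> = z ` {j \<in> J. \<alpha> \<le> w j}"
proof -
  \<comment> \<open>The inserted 0 is the value off the support and cuts off negative
    weights.\<close>
  define C where "C = (\<lambda>x. Max (insert 0 (w ` {j \<in> J. z j = x})))"
  have fin: "finite (w ` {j \<in> J. z j = x})" for x using J by simp
  have lev: "level_set C \<alpha> = z ` {j \<in> J. \<alpha> \<le> w j}" if "0 < \<alpha>" for \<alpha>
    using that fin by (auto simp: level_set_def C_def Max_ge_iff simp del: Max_insert)
  have nonneg: "0 \<le> C x" for x unfolding C_def using fin by (intro Max_ge) auto
  have C_le: "C x \<le> l" for x unfolding C_def using fin le l by (subst Max_le_iff) auto
  obtain j where j: "j \<in> J" "w j = l" using att by auto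
  have "z j \<in> level_set C l" using j l by (simp add: lev)
  then have "C (z j) = l" using C_le[of "z j"] by (simp add: level_set_def)
  moreover have "closed (level_set C \<alpha>)" for \<alpha>
  proof (cases "0 < \<alpha>")
    case True
    then show ?thesis using J by (simp add: lev finite_imp_closed)
  next
    case False
    then have "level_set C \<alpha> = UNIV"
      using nonneg by (auto simp: level_set_def intro: order_trans[of _ 0])
    then show ?thesis by simp
  qed
  ultimately have "C \<in> fuzzy_sets_height l"
    using nonneg C_le order_trans[OF C_le l(2)]
    by (auto simp: fuzzy_sets_height_def fuzzy_sets_def upper_semicontinuous_iff_closed_level_set)
  with lev show ?thesis by blast
qed

lemma levelwise_dist_leI:
  assumes "\<And>\<alpha>. \<alpha> \<in> {0<..1} \<Longrightarrow> hausdorff_dist (level_set A \<alpha>) (level_set B \<alpha>) \<le> r"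
  shows "levelwise_dist A B \<le> r"
  unfolding levelwise_dist_def using assms by (intro cSUP_least) auto

text \<open>The weight \<open>w x\<close> is the maximum of \<open>A\<close> over the closed ball of
  radius \<open>e\<close> around \<open>x\<close>. A net point \<open>p\<close> close to a point
  where \<open>A\<close> takes the value \<open>l\<close> receives full weight.\<close>

lemma fuzzy_sets_height_local_max:
  fixes A :: "'a::metric_space \<Rightarrow> real"
  assumes c: "compact (UNIV :: 'a set)" and A: "A \<in> fuzzy_sets_height l"
    and e: "e > 0" and net: "\<And>u. \<exists>x\<in>P. dist x u < e"
  obtains w p where "\<And>x. w x \<le> l" "\<And>x \<alpha>. \<alpha> \<le> w x \<longleftrightarrow> (\<exists>u\<in>cball x e. \<alpha> \<le> A u)"
    "p \<in> P" "w p = l"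
proof -
  have "\<exists>v\<in>cball x e. \<forall>u\<in>cball x e. A u \<le> A v" for x
    using compact_Int_closed[OF c closed_cball, of x e] A e
    by (intro upper_semicontinuous_attains_max) (auto simp: fuzzy_sets_height_def fuzzy_sets_def)
  then obtain v where v: "\<And>x. v x \<in> cball x e" "\<And>x u. u \<in> cball x e \<Longrightarrow> A u \<le> A (v x)" by metis
  obtain u where u: "A u = l" using A by (auto simp: fuzzy_sets_height_def)
  obtain p where p: "p \<in> P" "dist p u < e" using net by blast
  show thesis
  proof
    show "p \<in> P" by (rule p)
    show "A (v p) = l"
      using A v(2)[of u p] u p(2) by (auto simp: fuzzy_sets_height_def intro: order_antisym)
    show "A (v x) \<le> l" for x using A by (simp add: fuzzy_sets_height_def)
    show "\<alpha> \<le> A (v x) \<longleftrightarrow> (\<exists>u\<in>cball x e. \<alpha> \<le> A u)" for x \<alpha>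
      using v order_trans by blast
  qed
qed

text \<open>A weight of at least \<alpha> at \<open>z x y\<close> certifies points of both level
  sets, within \<open>e\<close> of \<open>x\<close> and of \<open>y\<close>. Conversely, a point of
  one level set is reached by pairing its net point with a full-weight net point for the other fuzzy
  set. Each comparison passes through a net point and costs two errors of size
  \<open>e\<close>.\<close>

lemma fuzzy_set_joining:
  fixes A B :: "'a::metric_space \<Rightarrow> real" and f :: "'a \<Rightarrow> 'a"
  assumes c: "compact (UNIV :: 'a set)" and l: "0 < l" "l \<le> 1"
    and A: "A \<in> fuzzy_sets_height l" and B: "B \<in> fuzzy_sets_height l"
    and e: "e > 0" and P: "finite P" "\<And>u. \<exists>x\<in>P. dist x u < e"
    and z: "\<And>x y. x \<in> P \<Longrightarrow> y \<in> P \<Longrightarrow> dist x (z x y) < e \<and> dist y (f (z x y)) < e"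
  shows "\<exists>C\<in>fuzzy_sets_height l. levelwise_dist A C \<le> 2 * e \<and>
    (\<forall>\<alpha>>0. hausdorff_dist (level_set B \<alpha>) (f ` level_set C \<alpha>) \<le> 2 * e)"
proof -
  obtain v p where v: "\<And>x. v x \<le> l" "\<And>x \<alpha>. \<alpha> \<le> v x \<longleftrightarrow> (\<exists>u\<in>cball x e. \<alpha> \<le> A u)"
    and p: "p \<in> P" "v p = l"
    using fuzzy_sets_height_local_max[OF c A e P(2)] by metis
  obtain w q where w: "\<And>x. w x \<le> l" "\<And>x \<alpha>. \<alpha> \<le> w x \<longleftrightarrow> (\<exists>u\<in>cball x e. \<alpha> \<le> B u)"
    and q: "q \<in> P" "w q = l"
    using fuzzy_sets_height_local_max[OF c B e P(2)] by metis
  define wt where "wt = (\<lambda>(x, y). min (v x) (w y))"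
  have wt_att: "\<exists>j\<in>P \<times> P. wt j = l"
    using p q by (intro bexI[of _ "(p, q)"]) (auto simp: wt_def)
  have wt_le: "wt j \<le> l" for j
    using v(1) by (auto simp: wt_def min.coboundedI1 split: prod.split)
  obtain C where C: "C \<in> fuzzy_sets_height l"
    and lev: "\<And>\<alpha>. 0 < \<alpha> \<Longrightarrow> level_set C \<alpha> = (\<lambda>(x, y). z x y) ` {j \<in> P \<times> P. \<alpha> \<le> wt j}"
    using finitely_supported_fuzzy_set[OF finite_cartesian_product[OF P(1) P(1)] l wt_le wt_att,
        of "\<lambda>(x, y). z x y"] by auto
  have levD: "\<exists>x\<in>P. \<exists>y\<in>P. s = z x y \<and> \<alpha> \<le> v x \<and> \<alpha> \<le> w y" if "0 < \<alpha>" "s \<in> level_set C \<alpha>" for s \<alpha>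
    using that by (auto simp: lev wt_def) blast
  have levI: "z x y \<in> level_set C \<alpha>" if "0 < \<alpha>" "x \<in> P" "y \<in> P" "\<alpha> \<le> v x" "\<alpha> \<le> w y" for x y \<alpha>
    using that by (force simp: lev wt_def)
  have "hausdorff_dist (level_set A \<alpha>) (level_set C \<alpha>) \<le> 2 * e" if \<alpha>: "0 < \<alpha>" for \<alpha>
  proof (rule hausdorff_dist_leI[OF c])
    fix u assume u: "u \<in> level_set A \<alpha>"
    obtain x where x: "x \<in> P" "dist x u < e" using P by blast
    then have "\<alpha> \<le> v x" using u v(2) by (auto simp: level_set_def intro!: bexI[of _ u])
    \<comment> \<open>Pairing with \<open>q\<close> loses no weight, since \<open>v x\<close> is at
      most \<open>l = w q\<close>; this is where the equal heights enter.\<close>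
    then have "z x q \<in> level_set C \<alpha>" using \<alpha> x q v(1)[of x] by (intro levI) auto
    moreover have "dist u (z x q) \<le> 2 * e"
      using x z[OF x(1) q(1)] dist_triangle3[of u "z x q" x] by linarith
    ultimately show "\<exists>s\<in>level_set C \<alpha>. dist u s \<le> 2 * e" by blast
  next
    fix s assume "s \<in> level_set C \<alpha>"
    then obtain x y where xy: "x \<in> P" "y \<in> P" "s = z x y" "\<alpha> \<le> v x" using levD[OF \<alpha>] by blast
    then obtain u where u: "dist x u \<le> e" "\<alpha> \<le> A u" using v(2) by auto
    have "dist u s \<le> 2 * e"
      using z[OF xy(1,2), folded xy(3)] u(1) dist_triangle3[of u s x] by linarith
    then show "\<exists>u\<in>level_set A \<alpha>. dist u s \<le> 2 * e" using u(2) by (auto simp: level_set_def)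
  qed (use e in simp)
  then have "levelwise_dist A C \<le> 2 * e" by (intro levelwise_dist_leI) auto
  moreover have "hausdorff_dist (level_set B \<alpha>) (f ` level_set C \<alpha>) \<le> 2 * e" if \<alpha>: "0 < \<alpha>" for \<alpha>
  proof (rule hausdorff_dist_leI[OF c])
    fix u assume u: "u \<in> level_set B \<alpha>"
    obtain y where y: "y \<in> P" "dist y u < e" using P by blast
    then have "\<alpha> \<le> w y" using u w(2) by (auto simp: level_set_def intro!: bexI[of _ u])
    then have "z p y \<in> level_set C \<alpha>" using \<alpha> y p w(1)[of y] by (intro levI) auto
    moreover have "dist u (f (z p y)) \<le> 2 * e"
      using y z[OF p(1) y(1)] dist_triangle3[of u "f (z p y)" y] by linarith
    ultimately show "\<exists>s\<in>f ` level_set C \<alpha>. dist u s \<le> 2 * e" by blast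
  next
    fix s assume "s \<in> f ` level_set C \<alpha>"
    then obtain x y where xy: "x \<in> P" "y \<in> P" "s = f (z x y)" "\<alpha> \<le> w y" using levD[OF \<alpha>] by blast
    then obtain u where u: "dist y u \<le> e" "\<alpha> \<le> B u" using w(2) by auto
    have "dist u s \<le> 2 * e"
      using z[OF xy(1,2), folded xy(3)] u(1) dist_triangle3[of u s y] by linarith
    then show "\<exists>u\<in>level_set B \<alpha>. dist u s \<le> 2 * e" using u(2) by (auto simp: level_set_def)
  qed (use e in simp)
  ultimately show ?thesis using C by blast
qed

section \<open>Transfer of transitivity to and from fuzzy sets\<close>

lemma vec_transitive_fuzzy:
  fixes T :: "'a::metric_space \<Rightarrow> 'a"
  assumes ds: "dynamical_system T" and l: "0 < l" "l \<le> 1"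
    and wm: "weakly_mixing euclidean T" and tr: "vec_transitive n a euclidean T"
  shows "vec_transitive n a (fuzzy_topology l :: ('a \<Rightarrow> real) topology) (zadeh_extension T)"
  unfolding vec_transitive_iff
proof (intro allI impI)
  have c: "compact (UNIV :: 'a set)" and cont: "continuous_on UNIV T"
    using ds by (auto simp: dynamical_system_def)
  fix \<U> \<V> :: "nat \<Rightarrow> ('a \<Rightarrow> real) set"
  assume UV: "\<forall>i\<in>{1..n}. openin (fuzzy_topology l) (\<U> i) \<and> \<U> i \<noteq> {} \<and>
    openin (fuzzy_topology l) (\<V> i) \<and> \<V> i \<noteq> {}"
  have centre: "\<exists>A r. A \<in> fuzzy_sets_height l \<and> r > 0 \<and>
    (\<forall>C\<in>fuzzy_sets_height l. levelwise_dist A C < r \<longrightarrow> C \<in> \<W>)"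
    if "openin (fuzzy_topology l) \<W>" "\<W> \<noteq> {}" for \<W> :: "('a \<Rightarrow> real) set"
    using that unfolding openin_fuzzy_topology[OF ds] by blast
  have "\<forall>i\<in>{1..n}. \<exists>A r. A \<in> fuzzy_sets_height l \<and> r > 0 \<and>
    (\<forall>C\<in>fuzzy_sets_height l. levelwise_dist A C < r \<longrightarrow> C \<in> \<U> i)"
    using UV by (intro ballI centre) auto
  then obtain A r where A: "\<And>i. i \<in> {1..n} \<Longrightarrow> A i \<in> fuzzy_sets_height l"
    and r: "\<And>i. i \<in> {1..n} \<Longrightarrow> 0 < r i"
    and AU: "\<And>i C. i \<in> {1..n} \<Longrightarrow> C \<in> fuzzy_sets_height l \<Longrightarrow> levelwise_dist (A i) C < r i \<Longrightarrow> C \<in> \<U> i"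
    by metis
  have "\<forall>i\<in>{1..n}. \<exists>A r. A \<in> fuzzy_sets_height l \<and> r > 0 \<and>
    (\<forall>C\<in>fuzzy_sets_height l. levelwise_dist A C < r \<longrightarrow> C \<in> \<V> i)"
    using UV by (intro ballI centre) auto
  then obtain B s where B: "\<And>i. i \<in> {1..n} \<Longrightarrow> B i \<in> fuzzy_sets_height l"
    and s: "\<And>i. i \<in> {1..n} \<Longrightarrow> 0 < s i"
    and BV: "\<And>i C. i \<in> {1..n} \<Longrightarrow> C \<in> fuzzy_sets_height l \<Longrightarrow> levelwise_dist (B i) C < s i \<Longrightarrow> C \<in> \<V> i"
    by metis
  \<comment> \<open>A third of the smallest radius, so that the error \<open>2 * e\<close> stays
    strictly below every radius. The inserted 1 keeps the minimum meaningful for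
    \<open>n = 0\<close>.\<close>
  define e where "e = Min (insert 1 ((\<lambda>i. min (r i) (s i)) ` {1..n})) / 3"
  have e: "e > 0" using r s by (simp add: e_def)
  have e_less: "2 * e < r i" "2 * e < s i" if "i \<in> {1..n}" for i
  proof -
    have "Min (insert 1 ((\<lambda>i. min (r i) (s i)) ` {1..n})) \<le> min (r i) (s i)"
      using that by (intro Min_le) auto
    then have "3 * e \<le> min (r i) (s i)" by (simp add: e_def)
    then show "2 * e < r i" "2 * e < s i" using e by auto
  qed
  have "(UNIV :: 'a set) \<subseteq> (\<Union>x\<in>UNIV. ball x e)" using e by auto
  then obtain P where P: "finite P" "(UNIV :: 'a set) \<subseteq> (\<Union>x\<in>P. ball x e)"
    using compactE_image[OF c, of UNIV "\<lambda>x. ball x e"] by (metis open_ball)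
  obtain m where m: "\<And>i x y. i \<in> {1..n} \<Longrightarrow> x \<in> P \<Longrightarrow> y \<in> P \<Longrightarrow>
    \<exists>u. dist x u < e \<and> dist y ((T ^^ (a i * m)) u) < e"
  \<comment> \<open>One time serves every coordinate and every pair of net points, whose balls act
    as sources and targets.\<close>
  proof (rule weakly_mixing_vec_transitive_family[OF wm tr cont, of "P \<times> P"
        "\<lambda>i j. ball (fst j) e" "\<lambda>i j. ball (snd j) e"])
    show "finite (P \<times> P)" using P by simp
  next
    fix m assume *: "\<And>i j. i \<in> {1..n} \<Longrightarrow> j \<in> P \<times> P \<Longrightarrow>
      \<exists>x\<in>ball (fst j) e. (T ^^ (a i * m)) x \<in> ball (snd j) e"
    show thesis
    proof (rule that)
      fix i x y assume "i \<in> {1..n}" "x \<in> P" "y \<in> P"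
      then show "\<exists>u. dist x u < e \<and> dist y ((T ^^ (a i * m)) u) < e" using *[of i "(x, y)"] by auto
    qed
  qed (use e in auto)
  show "\<exists>m. \<forall>i\<in>{1..n}. \<exists>C\<in>\<U> i. (zadeh_extension T ^^ (a i * m)) C \<in> \<V> i"
  proof (intro exI[of _ m] ballI)
    fix i assume i: "i \<in> {1..n}"
    let ?f = "T ^^ (a i * m)"
    obtain z where z: "\<And>x y. x \<in> P \<Longrightarrow> y \<in> P \<Longrightarrow> dist x (z x y) < e \<and> dist y (?f (z x y)) < e"
      using m[OF i] by metis
    have net: "\<exists>x\<in>P. dist x u < e" for u using subsetD[OF P(2) UNIV_I, of u] by auto
    obtain C where C: "C \<in> fuzzy_sets_height l" "levelwise_dist (A i) C \<le> 2 * e"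
      "\<And>\<alpha>. 0 < \<alpha> \<Longrightarrow> hausdorff_dist (level_set (B i) \<alpha>) (?f ` level_set C \<alpha>) \<le> 2 * e"
      using fuzzy_set_joining[OF c l A[OF i] B[OF i] e P(1) net z] by blast
    have "levelwise_dist (B i) ((zadeh_extension T ^^ (a i * m)) C) \<le> 2 * e"
      using C(3) funpow_zadeh_extension[OF ds C(1)] by (intro levelwise_dist_leI) auto
    then have "(zadeh_extension T ^^ (a i * m)) C \<in> \<V> i"
      using BV[OF i] funpow_zadeh_extension[OF ds C(1)] e_less[OF i] by (meson le_less_trans)
    moreover have "C \<in> \<U> i" using AU[OF i C(1)] C(2) e_less[OF i] by linarith
    ultimately show "\<exists>C\<in>\<U> i. (zadeh_extension T ^^ (a i * m)) C \<in> \<V> i" by blast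
  qed
qed

text \<open>Taking the level set at the height \<open>l\<close> does not increase distances, is onto
  the hyperspace, and intertwines the two maps. Preimages of open sets therefore carry the required
  time.\<close>

lemma vec_transitive_hyperspace_of_fuzzy:
  fixes T :: "'a::metric_space \<Rightarrow> 'a"
  assumes ds: "dynamical_system T" and l: "0 < l" "l \<le> 1"
    and tr: "vec_transitive n a (fuzzy_topology l :: ('a \<Rightarrow> real) topology) (zadeh_extension T)"
  shows "vec_transitive n a hyperspace_topology (hyperspace_map T)"
  unfolding vec_transitive_iff
proof (intro allI impI)
  have c: "compact (UNIV :: 'a set)" using ds by (simp add: dynamical_system_def)
  fix \<U> \<V> :: "nat \<Rightarrow> 'a set set"
  assume UV: "\<forall>i\<in>{1..n}. openin hyperspace_topology (\<U> i) \<and> \<U> i \<noteq> {} \<and>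
    openin hyperspace_topology (\<V> i) \<and> \<V> i \<noteq> {}"
  let ?pre = "\<lambda>\<W> i. {A \<in> fuzzy_sets_height l. level_set A l \<in> \<W> i}"
  have pre: "openin (fuzzy_topology l) (?pre \<W> i) \<and> ?pre \<W> i \<noteq> {}"
    if W: "openin hyperspace_topology (\<W> i)" "\<W> i \<noteq> {}" for \<W> :: "nat \<Rightarrow> 'a set set" and i :: nat
  proof
    show "openin (fuzzy_topology l) (?pre \<W> i)"
      unfolding openin_fuzzy_topology[OF ds]
    proof (intro conjI ballI)
      fix A assume "A \<in> ?pre \<W> i"
      then obtain r where r: "r > 0"
        "\<And>K. K \<in> hyperspace \<Longrightarrow> hausdorff_dist (level_set A l) K < r \<Longrightarrow> K \<in> \<W> i"
        using W(1) unfolding openin_hyperspace_topology[OF ds] by blast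
      have "level_set B l \<in> \<W> i" if B: "B \<in> fuzzy_sets_height l" "levelwise_dist A B < r" for B
      proof (rule r(2))
        show "level_set B l \<in> hyperspace"
          using B(1) closed_level_set[of B l]
          by (force simp: hyperspace_def fuzzy_sets_height_def level_set_def)
        show "hausdorff_dist (level_set A l) (level_set B l) < r"
          using levelwise_dist_upper[OF c, of l A B] B(2) l by simp
      qed
      then show "\<exists>r>0. \<forall>B\<in>fuzzy_sets_height l. levelwise_dist A B < r \<longrightarrow> B \<in> ?pre \<W> i"
        using r(1) by blast
    qed auto
    obtain K where K: "K \<in> \<W> i" using W(2) by blast
    then have "K \<in> hyperspace" using W(1) unfolding openin_hyperspace_topology[OF ds] by blast
    then have K': "closed K" "K \<noteq> {}" by (auto simp: hyperspace_def)
    \<comment> \<open>Scaling the indicator of \<open>K\<close> by \<open>l\<close> gives a fuzzy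
      set of height \<open>l\<close> with top level \<open>K\<close>, which proves
      surjectivity.\<close>
    define A where "A = (\<lambda>x. if x \<in> K then l else 0)"
    have "level_set A \<alpha> = (if \<alpha> \<le> 0 then UNIV else if \<alpha> \<le> l then K else {})" for \<alpha>
      using l by (auto simp: level_set_def A_def)
    then have "A \<in> fuzzy_sets_height l" "level_set A l = K"
      using K' l
      by (auto simp: fuzzy_sets_height_def fuzzy_sets_def upper_semicontinuous_iff_closed_level_set)
        (auto simp: A_def)
    with K show "?pre \<W> i \<noteq> {}" by blast
  qed
  have "\<forall>i\<in>{1..n}. openin (fuzzy_topology l) (?pre \<U> i) \<and> ?pre \<U> i \<noteq> {} \<and>
    openin (fuzzy_topology l) (?pre \<V> i) \<and> ?pre \<V> i \<noteq> {}"
    using UV pre by meson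
  then obtain m where
    m: "\<forall>i\<in>{1..n}. \<exists>A\<in>?pre \<U> i. (zadeh_extension T ^^ (a i * m)) A \<in> ?pre \<V> i"
    using tr[unfolded vec_transitive_iff, rule_format, of "?pre \<U>" "?pre \<V>"] by auto
  show "\<exists>m. \<forall>i\<in>{1..n}. \<exists>K\<in>\<U> i. (hyperspace_map T ^^ (a i * m)) K \<in> \<V> i"
  proof (intro exI[of _ m] ballI)
    fix i assume "i \<in> {1..n}"
    then obtain A where A: "A \<in> fuzzy_sets_height l" "level_set A l \<in> \<U> i"
      "level_set ((zadeh_extension T ^^ (a i * m)) A) l \<in> \<V> i"
      using m by blast
    then show "\<exists>K\<in>\<U> i. (hyperspace_map T ^^ (a i * m)) K \<in> \<V> i"
      using funpow_zadeh_extension[OF ds A(1), of "a i * m" l] by (auto simp: funpow_hyperspace_map)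
  qed
qed

theorem theorem5:
  fixes T :: "'a::metric_space \<Rightarrow> 'a" and n :: nat and a :: "nat \<Rightarrow> nat"
  assumes "dynamical_system T"
    and "n \<ge> 1"
    and "\<And>i. i \<in> {1..n} \<Longrightarrow> a i \<ge> 1"
  shows "((weakly_mixing euclidean T \<and> vec_transitive n a euclidean T)
            \<longleftrightarrow> vec_transitive n a hyperspace_topology (hyperspace_map T))
       \<and> (vec_transitive n a hyperspace_topology (hyperspace_map T)
            \<longleftrightarrow> (\<forall>l\<in>{0<..1}. vec_transitive n a (fuzzy_topology l :: ('a \<Rightarrow> real) topology) (zadeh_extension T)))
       \<and> ((\<forall>l\<in>{0<..1}. vec_transitive n a (fuzzy_topology l :: ('a \<Rightarrow> real) topology) (zadeh_extension T))
            \<longleftrightarrow> (\<exists>l\<in>{0<..1}. vec_transitive n a (fuzzy_topology l :: ('a \<Rightarrow> real) topology) (zadeh_extension T)))"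
    (is "(?base \<longleftrightarrow> ?hyper) \<and> (_ \<longleftrightarrow> ?all) \<and> (_ \<longleftrightarrow> ?ex)")
proof -
  have "?base \<Longrightarrow> ?all" using vec_transitive_fuzzy[OF assms(1)] by auto
  moreover have "?all \<Longrightarrow> ?ex" by (rule bexI[of _ 1]) auto
  moreover have "?ex \<Longrightarrow> ?hyper" using vec_transitive_hyperspace_of_fuzzy[OF assms(1)] by auto
  moreover have "?hyper \<Longrightarrow> ?base"
    using weakly_mixing_of_hyperspace[OF assms(1,2)] vec_transitive_base_of_hyperspace[OF assms(1)]
    by blast
  ultimately show ?thesis by argo
qed

end
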